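(* Suppose $f:\mathbb{R}^d\to\mathbb{R}$ is differentiable with $\nabla f$ Lipschitz continuous with constant $L_f$, and $g:\mathbb{R}^d\to\mathbb{R}\cup\{+\infty\}$ is proper, lower semicontinuous and $\rho$-weakly convex. Then, for $\gamma\in(0,\rho^{-1})$, the operator $Y^{\rm FB}_{f,g}(\cdot,\gamma)$ is Lipschitz continuous; more specifically, for all $u_1,u_2\in\mathbb{R}^d$, $$\|Y^{\rm FB}_{f,g}(u_1,\gamma)-Y^{\rm FB}_{f,g}(u_2,\gamma)\|\le\Big(\frac{1+\gamma L_f}{1-\gamma\rho}\Big)\|u_1-u_2\|.$$
   Context: A function $g$ is $\rho$-weakly convex ($\rho\ge0$) if $g+\frac{\rho}{2}\|\cdot\|^2$ is convex. $\mathrm{prox}_{\gamma g}(x):=\mathrm{argmin}_{y\in\mathbb{R}^d}\{g(y)+\frac1{2\gamma}\|y-x\|^2\}$, which is single-valued for $\gamma\in(0,\rho^{-1})$ (with $0^{-1}=+\infty$). The forward-backward map is $Y^{\rm FB}_{f,g}(x,\gamma):=\mathrm{prox}_{\gamma g}(x-\gamma\nabla f(x))$. *)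

theory Defs
  imports "HOL-Analysis.Analysis"
begin

definition gradient :: "('a::real_inner \<Rightarrow> real) \<Rightarrow> 'a \<Rightarrow> 'a" where
  "gradient f x = (THE D. GDERIV f x :> D)"

text \<open>Functions with values in \<open>\<real> \<union> {+\<infinity>}\<close> are modelled as \<^typ>\<open>ereal\<close>-valued functions;
  the value \<open>-\<infinity>\<close> is excluded by properness.\<close>

definition proper :: "('a \<Rightarrow> ereal) \<Rightarrow> bool" where
  "proper g \<longleftrightarrow> (\<forall>x. g x \<noteq> - \<infinity>) \<and> (\<exists>x. g x \<noteq> \<infinity>)"

definition lower_semicontinuous :: "('a::topological_space \<Rightarrow> ereal) \<Rightarrow> bool" where
  "lower_semicontinuous g \<longleftrightarrow> (\<forall>x. g x \<le> Liminf (at x) g)"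

text \<open>The library's \<^const>\<open>convex_on\<close> covers only real-valued functions. At the endpoints
  \<open>u = 0\<close> and \<open>v = 0\<close> the convention \<open>0 * \<infinity> = 0\<close> of \<^typ>\<open>ereal\<close> makes the inequality trivial.\<close>

definition convex_ereal :: "('a::real_vector \<Rightarrow> ereal) \<Rightarrow> bool" where
  "convex_ereal h \<longleftrightarrow>
    (\<forall>x y. \<forall>u\<ge>0. \<forall>v\<ge>0. u + v = 1 \<longrightarrow>
      h (u *\<^sub>R x + v *\<^sub>R y) \<le> ereal u * h x + ereal v * h y)"

definition weakly_convex :: "real \<Rightarrow> ('a::real_normed_vector \<Rightarrow> ereal) \<Rightarrow> bool" where
  "weakly_convex \<rho> g \<longleftrightarrow> convex_ereal (\<lambda>x. g x + ereal (\<rho> / 2 * (norm x)\<^sup>2))"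

text \<open>The definite description refers to the argmin only where the minimiser exists and is
  unique; this is the case for proper, lower semicontinuous, \<open>\<rho>\<close>-weakly convex \<open>g\<close> on a
  Euclidean space and \<open>\<gamma> \<in> (0, \<rho>\<^sup>-\<^sup>1)\<close>.\<close>

definition prox :: "real \<Rightarrow> ('a::real_normed_vector \<Rightarrow> ereal) \<Rightarrow> 'a \<Rightarrow> 'a" where
  "prox \<gamma> g x =
    (THE y. is_arg_min (\<lambda>y. g y + ereal (1 / (2 * \<gamma>) * (norm (y - x))\<^sup>2)) (\<lambda>_. True) y)"

definition Y_FB :: "('a::real_inner \<Rightarrow> real) \<Rightarrow> ('a \<Rightarrow> ereal) \<Rightarrow> 'a \<Rightarrow> real \<Rightarrow> 'a" where
  "Y_FB f g x \<gamma> = prox \<gamma> g (x - \<gamma> *\<^sub>R gradient f x)"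

end

theory Submission
  imports Defs
begin

text \<open>The proximal objective \<open>y \<mapsto> g y + \<parallel>y - x\<parallel>\<^sup>2 / (2\<gamma>)\<close> is strongly convex with modulus
  \<open>m = 1/\<gamma> - \<rho> > 0\<close>. Strong convexity forces it to grow quadratically away from any point of the
  domain, so it has a minimiser \<open>p\<close>, and it exceeds its minimum by at least \<open>m/2 * \<parallel>y - p\<parallel>\<^sup>2\<close>.
  Adding this growth estimate for two centres \<open>x\<^sub>1\<close>, \<open>x\<^sub>2\<close>, each tested at the other's minimiser, gives
  \<open>m * \<parallel>p\<^sub>1 - p\<^sub>2\<parallel>\<^sup>2 \<le> (x\<^sub>1 - x\<^sub>2) \<bullet> (p\<^sub>1 - p\<^sub>2) / \<gamma>\<close>; hence \<open>prox\<close> has Lipschitz constant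
  \<open>1 / (1 - \<gamma>\<rho>)\<close>, while the forward step has Lipschitz constant \<open>1 + \<gamma>L\<^sub>f\<close>.\<close>

text \<open>Weierstrass' theorem for lower semicontinuous functions. Among finitely many points of
  \<open>K\<close>, the one with the least value lies in the sublevel sets at the values of all the
  others, so these closed sets have the finite intersection property on \<open>K\<close>. A point of
  \<open>K\<close> common to all of them is a minimiser.\<close>

lemma compact_attains_Inf_closed_sublevels:
  fixes \<phi> :: "'a::topological_space \<Rightarrow> 'b::linorder"
  assumes K: "compact K" "K \<noteq> {}"
    and closed: "\<And>c. closed {x. \<phi> x \<le> c}"
  shows "\<exists>x\<in>K. \<forall>y\<in>K. \<phi> x \<le> \<phi> y"
proof -
  have "K \<inter> (\<Inter>k\<in>K. {x. \<phi> x \<le> \<phi> k}) \<noteq> {}"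
  proof (rule compact_imp_fip_image[OF K(1)])
    fix I assume I: "finite I" "I \<subseteq> K"
    show "K \<inter> (\<Inter>k\<in>I. {x. \<phi> x \<le> \<phi> k}) \<noteq> {}"
    proof (cases "I = {}")
      case True
      then show ?thesis using K by auto
    next
      case False
      then have "Min (\<phi> ` I) \<in> \<phi> ` I" using I by simp
      then obtain k where k: "k \<in> I" "\<phi> k = Min (\<phi> ` I)" by (metis imageE)
      then have "\<phi> k \<le> \<phi> l" if "l \<in> I" for l using I that by simp
      then show ?thesis using k I by blast
    qed
  qed (rule closed)
  then show ?thesis by auto
qed

text \<open>Supplies the closedness that the existence of minimisers rests on. The complement is
  open: where the sum exceeds \<open>c\<close>, a real \<open>d\<close> fits strictly between
  \<open>c - q x\<close> and \<open>g x\<close>; near \<open>x\<close>, lower semicontinuity keeps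
  \<open>g\<close> above \<open>d\<close>, and continuity keeps \<open>d + q\<close> above
  \<open>c\<close>.\<close>

lemma closed_sublevel_lower_semicontinuous_add:
  fixes g :: "'a::topological_space \<Rightarrow> ereal"
  assumes g: "lower_semicontinuous g" and q: "continuous_on UNIV q"
  shows "closed {x. g x + ereal (q x) \<le> c}"
proof -
  have "eventually (\<lambda>y. c < g y + ereal (q y)) (nhds x)" if x: "c < g x + ereal (q x)" for x
  proof -
    have "c - ereal (q x) < g x"
      using x by (cases c; cases "g x") auto
    then obtain d where d: "c - ereal (q x) < ereal d" "ereal d < g x"
      using ereal_dense2 by blast
    have "g x \<le> Liminf (at x) g"
      using g by (simp add: lower_semicontinuous_def)
    then have "eventually (\<lambda>y. ereal d < g y) (at x)"
      using d(2) by (simp add: le_Liminf_iff)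
    \<comment> \<open>The filter \<open>at x\<close> omits \<open>x\<close> itself, where the
      inequality is \<open>d(2)\<close>.\<close>
    then have 1: "eventually (\<lambda>y. ereal d < g y) (nhds x)"
      using d(2) by (auto simp: eventually_at_filter elim!: eventually_mono)
    have "c < ereal (d + q x)"
      using d(1) by (cases c) auto
    moreover have "((\<lambda>y. ereal (d + q y)) \<longlongrightarrow> ereal (d + q x)) (nhds x)"
    proof -
      have "(q \<longlongrightarrow> q x) (nhds x)"
        using q by (simp add: continuous_on_def flip: tendsto_at_iff_tendsto_nhds)
      then show ?thesis by (auto intro!: tendsto_intros)
    qed
    ultimately have 2: "eventually (\<lambda>y. c < ereal (d + q y)) (nhds x)"
      by (metis order_tendstoD(1))
    show ?thesis
      using 1 2
    proof eventually_elim
      case (elim y)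
      have "ereal (d + q y) \<le> g y + ereal (q y)"
        using elim(1) by (cases "g y") auto
      then show ?case using elim(2) by order
    qed
  qed
  then have "\<exists>T. open T \<and> x \<in> T \<and> T \<subseteq> {x. c < g x + ereal (q x)}"
    if "x \<in> {x. c < g x + ereal (q x)}" for x
    using that by (simp add: eventually_nhds subset_iff) metis
  then have "open {x. c < g x + ereal (q x)}"
    by (rule topological_space_class.openI)
  then show ?thesis
    by (simp add: closed_def Compl_eq not_le)
qed

lemma norm_convex_combination:
  fixes x y :: "'a::real_inner"
  assumes "u + v = (1::real)"
  shows "(norm (u *\<^sub>R x + v *\<^sub>R y))\<^sup>2 = u * (norm x)\<^sup>2 + v * (norm y)\<^sup>2 - u * v * (norm (x - y))\<^sup>2"
proof -
  have u: "u = 1 - v" using assms by simp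
  show ?thesis
    unfolding u power2_norm_eq_inner
    by (simp add: inner_simps inner_commute) (simp add: algebra_simps power2_eq_square)
qed

text \<open>By \<open>norm_convex_combination\<close>, the added quadratic gains exactly
  \<open>k / 2 * (u * v) * (norm (x - y))\<^sup>2\<close> on a segment, and weak convexity of
  \<open>g\<close> costs at most the same expression with \<open>\<rho>\<close> for
  \<open>k\<close>. The net modulus of strong convexity is \<open>k - \<rho>\<close>, whatever the
  centre \<open>w\<close>. Fixing real values \<open>a\<close> and \<open>b\<close> keeps the
  right-hand side in real arithmetic.\<close>

lemma weakly_convex_add_quadratic:
  fixes g :: "'a::real_inner \<Rightarrow> ereal"
  assumes g: "weakly_convex \<rho> g"
    and x: "g x + ereal (k / 2 * (norm (x - w))\<^sup>2) = ereal a"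
    and y: "g y + ereal (k / 2 * (norm (y - w))\<^sup>2) = ereal b"
    and uv: "0 \<le> u" "0 \<le> v" "u + v = 1"
  shows "g (u *\<^sub>R x + v *\<^sub>R y) + ereal (k / 2 * (norm (u *\<^sub>R x + v *\<^sub>R y - w))\<^sup>2)
    \<le> ereal (u * a + v * b - (k - \<rho>) / 2 * (u * v) * (norm (x - y))\<^sup>2)"
proof -
  obtain a' where a': "g x = ereal a'" using x by (cases "g x") auto
  obtain b' where b': "g y = ereal b'" using y by (cases "g y") auto
  let ?z = "u *\<^sub>R x + v *\<^sub>R y"
  have "?z - w = u *\<^sub>R (x - w) + v *\<^sub>R (y - w)"
    using uv(3) by (simp add: algebra_simps flip: scaleR_add_left)
  then have nw: "(norm (?z - w))\<^sup>2
      = u * (norm (x - w))\<^sup>2 + v * (norm (y - w))\<^sup>2 - u * v * (norm (x - y))\<^sup>2"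
    using norm_convex_combination[OF uv(3), of "x - w" "y - w"] by simp
  have a: "a = a' + k / 2 * (norm (x - w))\<^sup>2" using x a' by simp
  have b: "b = b' + k / 2 * (norm (y - w))\<^sup>2" using y b' by simp
  have le: "g ?z + ereal (\<rho> / 2 * (norm ?z)\<^sup>2)
      \<le> ereal (u * (a' + \<rho> / 2 * (norm x)\<^sup>2) + v * (b' + \<rho> / 2 * (norm y)\<^sup>2))"
  proof -
    have "g ?z + ereal (\<rho> / 2 * (norm ?z)\<^sup>2)
        \<le> ereal u * (g x + ereal (\<rho> / 2 * (norm x)\<^sup>2))
          + ereal v * (g y + ereal (\<rho> / 2 * (norm y)\<^sup>2))"
      using g uv unfolding weakly_convex_def convex_ereal_def by blast
    then show ?thesis by (simp add: a' b')
  qed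
  then show ?thesis
  proof (cases "g ?z")
    case (real c)
    then have "c + \<rho> / 2 * (norm ?z)\<^sup>2
      \<le> u * (a' + \<rho> / 2 * (norm x)\<^sup>2) + v * (b' + \<rho> / 2 * (norm y)\<^sup>2)"
      using le by simp
    then show ?thesis
      unfolding real norm_convex_combination[OF uv(3), of x y] nw a b
      by (simp add: field_simps)
  qed auto
qed

text \<open>Compare \<open>p\<close> with the nearby point
  \<open>(1 - v) *\<^sub>R p + v *\<^sub>R y\<close>. Minimality bounds its value below by
  \<open>a\<close>, and strong convexity bounds it above; dividing by \<open>v\<close> and letting
  \<open>v\<close> tend to 0 from the right gives the claim.\<close>

lemma minimizer_quadratic_growth:
  fixes \<phi> :: "'a::real_inner \<Rightarrow> ereal"
  assumes sc: "\<And>x y a b u v. \<phi> x = ereal a \<Longrightarrow> \<phi> y = ereal b \<Longrightarrow> 0 \<le> u \<Longrightarrow> 0 \<le> v \<Longrightarrow> u + v = 1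
      \<Longrightarrow> \<phi> (u *\<^sub>R x + v *\<^sub>R y) \<le> ereal (u * a + v * b - m / 2 * (u * v) * (norm (x - y))\<^sup>2)"
    and p: "\<And>y. \<phi> p \<le> \<phi> y" and a: "\<phi> p = ereal a" and b: "\<phi> y = ereal b"
  shows "a + m / 2 * (norm (y - p))\<^sup>2 \<le> b"
proof (rule tendsto_lowerbound)
  let ?D = "m / 2 * (norm (y - p))\<^sup>2"
  show "((\<lambda>v. b + v * ?D) \<longlongrightarrow> b) (at_right 0)"
    by (auto intro!: tendsto_eq_intros)
  have "a + ?D \<le> b + v * ?D" if v: "v \<in> {0<..<1}" for v
  proof -
    have "ereal a \<le> \<phi> ((1 - v) *\<^sub>R p + v *\<^sub>R y)"
      using p a by metis
    also have "\<dots> \<le> ereal ((1 - v) * a + v * b - m / 2 * ((1 - v) * v) * (norm (p - y))\<^sup>2)"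
      using v by (intro sc[OF a b]) auto
    finally have "v * (a + ?D) \<le> v * (b + v * ?D)"
      by (simp add: algebra_simps diff_divide_distrib norm_minus_commute)
    then show ?thesis using v by simp
  qed
  then show "eventually (\<lambda>v. a + ?D \<le> b + v * ?D) (at_right 0)"
    using eventually_at_right_real[of 0 1] by (auto elim: eventually_mono)
qed simp

text \<open>On the unit ball around a point \<open>x0\<close> of the domain, compactness gives a
  least value \<open>c\<close>. Strong convexity carries this bound outward along rays and shows
  that no value outside a larger ball falls below \<open>\<phi> x0\<close>. A minimiser on the
  larger ball is therefore global.\<close>

lemma strongly_convex_has_minimizer:
  fixes \<phi> :: "'a::euclidean_space \<Rightarrow> ereal"
  assumes sc: "\<And>x y a b u v. \<phi> x = ereal a \<Longrightarrow> \<phi> y = ereal b \<Longrightarrow> 0 \<le> u \<Longrightarrow> 0 \<le> v \<Longrightarrow> u + v = 1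
      \<Longrightarrow> \<phi> (u *\<^sub>R x + v *\<^sub>R y) \<le> ereal (u * a + v * b - m / 2 * (u * v) * (norm (x - y))\<^sup>2)"
    and m: "0 < m" and \<phi>: "proper \<phi>" and closed: "\<And>c. closed {x. \<phi> x \<le> c}"
  shows "\<exists>p. \<forall>y. \<phi> p \<le> \<phi> y"
proof -
  obtain x0 a where a: "\<phi> x0 = ereal a"
    using \<phi> unfolding proper_def by (metis ereal_cases)
  obtain z where z: "\<And>y. y \<in> cball x0 1 \<Longrightarrow> \<phi> z \<le> \<phi> y"
    using compact_attains_Inf_closed_sublevels[OF compact_cball _ closed, of x0 1] by fastforce
  have "\<phi> z \<le> ereal a" using z[of x0] a by simp
  then obtain c where c: "\<phi> z = ereal c"
    using \<phi> unfolding proper_def by (cases "\<phi> z") auto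
  have ca: "c \<le> a" using \<open>\<phi> z \<le> ereal a\<close> c by simp
  \<comment> \<open>Chosen so that \<open>t > R\<close> makes the factor
    \<open>c - a + m / 2 * (t - 1)\<close> below nonnegative. The summand 1 puts such points outside
    the unit ball.\<close>
  define R where "R = 1 + 2 * (a - c) / m"
  have R: "1 \<le> R" using ca m by (simp add: R_def)
  have far: "\<phi> x0 \<le> \<phi> y" if y: "R < norm (y - x0)" for y
  proof (cases "\<phi> y")
    case (real b)
    define t where "t = norm (y - x0)"
    have t: "1 < t" "R < t" using y R by (auto simp: t_def)
    \<comment> \<open>The point where the segment from \<open>x0\<close> to \<open>y\<close> crosses
      the unit sphere around \<open>x0\<close>; its value is at least \<open>c\<close>.\<close>
    let ?w = "(1 - 1 / t) *\<^sub>R x0 + (1 / t) *\<^sub>R y"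
    have "?w - x0 = (1 / t) *\<^sub>R (y - x0)" by (simp add: algebra_simps)
    then have "norm (?w - x0) = 1" using t by (auto simp: t_def)
    then have "ereal c \<le> \<phi> ?w"
      using z[of ?w] c by (simp add: dist_norm norm_minus_commute)
    also have "\<dots> \<le> ereal ((1 - 1 / t) * a + 1 / t * b - m / 2 * ((1 - 1 / t) * (1 / t)) * t\<^sup>2)"
      using sc[OF a real, of "1 - 1 / t" "1 / t"] t
      by (simp add: t_def[symmetric, unfolded norm_minus_commute[of y]])
    finally have "c \<le> (1 - 1 / t) * a + 1 / t * b - m / 2 * ((1 - 1 / t) * (1 / t)) * t\<^sup>2"
      by simp
    \<comment> \<open>Multiplying by \<open>t\<close> isolates \<open>b\<close> and leaves a lower
      bound for it that is quadratic in the distance \<open>t\<close>.\<close>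
    then have "t * c \<le> t * ((1 - 1 / t) * a + 1 / t * b - m / 2 * ((1 - 1 / t) * (1 / t)) * t\<^sup>2)"
      using t by simp
    also have "\<dots> = (t - 1) * a + b - m / 2 * (t - 1) * t"
      using t by (simp add: field_simps power2_eq_square)
    finally have b: "a + t * (c - a + m / 2 * (t - 1)) \<le> b"
      by (simp add: algebra_simps)
    have "2 * (a - c) / m < t - 1" using t by (simp add: R_def)
    then have "0 \<le> c - a + m / 2 * (t - 1)" using m by (simp add: field_simps)
    then have "0 \<le> t * (c - a + m / 2 * (t - 1))" using t by simp
    then show ?thesis using b a real by simp
  qed (use \<phi> in \<open>auto simp: proper_def\<close>)
  have "cball x0 R \<noteq> {}" using R by simp
  then obtain p where p: "\<And>y. y \<in> cball x0 R \<Longrightarrow> \<phi> p \<le> \<phi> y"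
    using compact_attains_Inf_closed_sublevels[OF compact_cball _ closed, of x0 R] by metis
  have "\<phi> p \<le> \<phi> y" for y
  proof (cases "y \<in> cball x0 R")
    case False
    then have "\<phi> x0 \<le> \<phi> y" by (intro far) (simp add: dist_norm norm_minus_commute)
    moreover have "\<phi> p \<le> \<phi> x0" using p R by simp
    ultimately show ?thesis by order
  qed (rule p)
  then show ?thesis by blast
qed

text \<open>Justifies the definite description in \<open>prox\<close>: strong convexity of the
  objective yields a minimiser, and quadratic growth makes it unique. Later arguments need only the
  finite value of \<open>g\<close> at the proximal point and the growth estimate there.\<close>

lemma prox_quadratic_growth:
  fixes g :: "'a::euclidean_space \<Rightarrow> ereal"
  assumes g: "proper g" "lower_semicontinuous g" "weakly_convex \<rho> g"
    and \<gamma>: "0 < \<gamma>" "\<gamma> * \<rho> < 1"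
  obtains a where "g (prox \<gamma> g x) = ereal a"
    and "\<And>y b. g y = ereal b \<Longrightarrow>
      a + 1 / (2 * \<gamma>) * (norm (prox \<gamma> g x - x))\<^sup>2 + (1 / \<gamma> - \<rho>) / 2 * (norm (y - prox \<gamma> g x))\<^sup>2
        \<le> b + 1 / (2 * \<gamma>) * (norm (y - x))\<^sup>2"
proof -
  define \<phi> where "\<phi> y = g y + ereal (1 / (2 * \<gamma>) * (norm (y - x))\<^sup>2)" for y
  have sc: "\<phi> (u *\<^sub>R y + v *\<^sub>R z)
      \<le> ereal (u * a + v * b - (1 / \<gamma> - \<rho>) / 2 * (u * v) * (norm (y - z))\<^sup>2)"
    if "\<phi> y = ereal a" "\<phi> z = ereal b" "0 \<le> u" "0 \<le> v" "u + v = 1" for y z a b u v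
    using weakly_convex_add_quadratic[OF g(3), of y "1 / \<gamma>" x a z b u v] that
    by (simp add: \<phi>_def mult.commute)
  have m: "0 < 1 / \<gamma> - \<rho>" using \<gamma> by (simp add: field_simps)
  have "proper \<phi>" using g(1) by (auto simp: proper_def \<phi>_def)
  moreover have "closed {y. \<phi> y \<le> c}" for c
    unfolding \<phi>_def by (intro closed_sublevel_lower_semicontinuous_add g continuous_intros)
  ultimately obtain p where p: "\<And>y. \<phi> p \<le> \<phi> y"
    using strongly_convex_has_minimizer[of \<phi>, OF sc m] by blast
  obtain y0 where "\<phi> y0 \<noteq> \<infinity>" using \<open>proper \<phi>\<close> by (auto simp: proper_def)
  then have "\<phi> p \<noteq> \<infinity>" using p[of y0] by auto
  then obtain c where c: "\<phi> p = ereal c"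
    using \<open>proper \<phi>\<close> by (cases "\<phi> p") (auto simp: proper_def)
  have growth: "c + (1 / \<gamma> - \<rho>) / 2 * (norm (y - p))\<^sup>2 \<le> b" if "\<phi> y = ereal b" for y b
    by (rule minimizer_quadratic_growth[of \<phi>, OF sc p c that])
  \<comment> \<open>A second minimiser has the same value \<open>c\<close>, so growth around
    \<open>p\<close> leaves no room for a positive distance.\<close>
  have "q = p" if q: "\<And>y. \<phi> q \<le> \<phi> y" for q
  proof -
    have "\<phi> q = ereal c" using p[of q] q[of p] c by simp
    then have "(1 / \<gamma> - \<rho>) / 2 * (norm (q - p))\<^sup>2 \<le> 0" using growth by force
    then show ?thesis using m by (simp add: mult_le_0_iff)
  qed
  then have prox: "prox \<gamma> g x = p"
    unfolding prox_def \<phi>_def[symmetric] is_arg_min_def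
    using p by (intro the_equality) (auto simp: not_less)
  obtain a where a: "g p = ereal a" using c by (cases "g p") (auto simp: \<phi>_def)
  show thesis
  proof (rule that)
    show "g (prox \<gamma> g x) = ereal a" by (simp add: prox a)
    fix y b assume "g y = ereal b"
    then show "a + 1 / (2 * \<gamma>) * (norm (prox \<gamma> g x - x))\<^sup>2
        + (1 / \<gamma> - \<rho>) / 2 * (norm (y - prox \<gamma> g x))\<^sup>2 \<le> b + 1 / (2 * \<gamma>) * (norm (y - x))\<^sup>2"
      using growth[of y] c by (simp add: prox \<phi>_def a)
  qed
qed

lemma prox_lipschitz:
  fixes g :: "'a::euclidean_space \<Rightarrow> ereal"
  assumes g: "proper g" "lower_semicontinuous g" "weakly_convex \<rho> g"
    and \<gamma>: "0 < \<gamma>" "\<gamma> * \<rho> < 1"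
  shows "norm (prox \<gamma> g x - prox \<gamma> g y) \<le> norm (x - y) / (1 - \<gamma> * \<rho>)"
proof -
  define p q where "p = prox \<gamma> g x" and "q = prox \<gamma> g y"
  obtain a where a: "g p = ereal a" and x: "\<And>z b. g z = ereal b \<Longrightarrow>
      a + 1 / (2 * \<gamma>) * (norm (p - x))\<^sup>2 + (1 / \<gamma> - \<rho>) / 2 * (norm (z - p))\<^sup>2
        \<le> b + 1 / (2 * \<gamma>) * (norm (z - x))\<^sup>2"
    using prox_quadratic_growth[OF assms] unfolding p_def by metis
  obtain b where b: "g q = ereal b" and y: "\<And>z c. g z = ereal c \<Longrightarrow>
      b + 1 / (2 * \<gamma>) * (norm (q - y))\<^sup>2 + (1 / \<gamma> - \<rho>) / 2 * (norm (z - q))\<^sup>2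
        \<le> c + 1 / (2 * \<gamma>) * (norm (z - y))\<^sup>2"
    using prox_quadratic_growth[OF assms] unfolding q_def by metis
  \<comment> \<open>In the sum of the two growth estimates the values \<open>a\<close> and
    \<open>b\<close> cancel, and the two halves of the modulus add up to the whole.\<close>
  have "(1 / \<gamma> - \<rho>) * (norm (p - q))\<^sup>2
      \<le> 1 / (2 * \<gamma>) * ((norm (q - x))\<^sup>2 - (norm (p - x))\<^sup>2 + (norm (p - y))\<^sup>2 - (norm (q - y))\<^sup>2)"
    using x[OF b] y[OF a] by (simp add: algebra_simps diff_divide_distrib norm_minus_commute)
  \<comment> \<open>Each of the four squared norms occurs once with either sign, so only the mixed
    inner products survive.\<close>
  also have "(norm (q - x))\<^sup>2 - (norm (p - x))\<^sup>2 + (norm (p - y))\<^sup>2 - (norm (q - y))\<^sup>2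
      = 2 * ((x - y) \<bullet> (p - q))"
    unfolding power2_norm_eq_inner by (simp add: inner_simps inner_commute)
  finally have "\<gamma> * ((1 / \<gamma> - \<rho>) * (norm (p - q))\<^sup>2)
      \<le> \<gamma> * (1 / (2 * \<gamma>) * (2 * ((x - y) \<bullet> (p - q))))"
    using \<gamma>(1) by (intro mult_left_mono) auto
  then have "(1 - \<gamma> * \<rho>) * (norm (p - q))\<^sup>2 \<le> (x - y) \<bullet> (p - q)"
    using \<gamma>(1) by (simp add: algebra_simps)
  also have "\<dots> \<le> norm (x - y) * norm (p - q)"
    by (rule norm_cauchy_schwarz)
  \<comment> \<open>One factor \<open>norm (p - q)\<close> is cancelled, which needs
    \<open>p\<close> and \<open>q\<close> to be distinct; if they coincide, the left-hand side is
    0.\<close>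
  finally have "(1 - \<gamma> * \<rho>) * norm (p - q) \<le> norm (x - y)"
    by (cases "p = q") (simp_all add: power2_eq_square)
  then show ?thesis
    using \<gamma>(2) by (simp add: p_def q_def field_simps)
qed

lemma forward_step_lipschitz:
  assumes "L-lipschitz_on UNIV F" "0 \<le> \<gamma>"
  shows "norm ((u - \<gamma> *\<^sub>R F u) - (v - \<gamma> *\<^sub>R F v)) \<le> (1 + \<gamma> * L) * norm (u - v)"
proof -
  have "norm ((u - \<gamma> *\<^sub>R F u) - (v - \<gamma> *\<^sub>R F v)) = norm ((u - v) - \<gamma> *\<^sub>R (F u - F v))"
    by (simp add: algebra_simps)
  also have "\<dots> \<le> norm (u - v) + \<gamma> * norm (F u - F v)"
    using norm_triangle_ineq4[of "u - v" "\<gamma> *\<^sub>R (F u - F v)"] assms(2) by simp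
  also have "\<dots> \<le> norm (u - v) + \<gamma> * (L * norm (u - v))"
    using lipschitz_onD[OF assms(1), of u v] assms(2) by (simp add: dist_norm mult_left_mono)
  finally show ?thesis by (simp add: algebra_simps)
qed

theorem proposition3:
  fixes f :: "real ^ 'd \<Rightarrow> real"
    and g :: "real ^ 'd \<Rightarrow> ereal"
    and L\<^sub>f \<rho> \<gamma> :: real
  assumes "f differentiable_on UNIV"
    and "L\<^sub>f-lipschitz_on UNIV (gradient f)"
    and "proper g"
    and "lower_semicontinuous g"
    and "0 \<le> \<rho>"
    and "weakly_convex \<rho> g"
    and "0 < \<gamma>"
    and "ereal \<gamma> < inverse (ereal \<rho>)"
  shows "(\<exists>C. C-lipschitz_on UNIV (\<lambda>u. Y_FB f g u \<gamma>)) \<and>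
    (\<forall>u\<^sub>1 u\<^sub>2. norm (Y_FB f g u\<^sub>1 \<gamma> - Y_FB f g u\<^sub>2 \<gamma>)
      \<le> (1 + \<gamma> * L\<^sub>f) / (1 - \<gamma> * \<rho>) * norm (u\<^sub>1 - u\<^sub>2))"
proof -
  \<comment> \<open>For \<open>\<rho> = 0\<close> the extended inverse is \<open>\<infinity>\<close>
    and the product is 0; otherwise the bound on \<open>\<gamma>\<close> is multiplied by the
    positive number \<open>\<rho>\<close>.\<close>
  have \<gamma>\<rho>: "\<gamma> * \<rho> < 1"
    using assms(5,7,8) by (cases "\<rho> = 0") (auto simp: field_simps)
  have L: "0 \<le> L\<^sub>f" using assms(2) by (rule lipschitz_on_nonneg)
  have bound: "norm (Y_FB f g u \<gamma> - Y_FB f g v \<gamma>)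
      \<le> (1 + \<gamma> * L\<^sub>f) / (1 - \<gamma> * \<rho>) * norm (u - v)" for u v
  proof -
    have "norm (Y_FB f g u \<gamma> - Y_FB f g v \<gamma>)
        \<le> norm ((u - \<gamma> *\<^sub>R gradient f u) - (v - \<gamma> *\<^sub>R gradient f v)) / (1 - \<gamma> * \<rho>)"
      unfolding Y_FB_def by (rule prox_lipschitz) (use assms \<gamma>\<rho> in auto)
    also have "\<dots> \<le> (1 + \<gamma> * L\<^sub>f) * norm (u - v) / (1 - \<gamma> * \<rho>)"
      using \<gamma>\<rho> assms(7) by (intro divide_right_mono forward_step_lipschitz[OF assms(2)]) auto
    finally show ?thesis by simp
  qed
  \<comment> \<open>\<open>lipschitz_on\<close> also demands a nonnegative constant; this follows
    from \<open>L\<close>, \<open>\<gamma>\<rho>\<close> and the positivity of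
    \<open>\<gamma>\<close>.\<close>
  have "((1 + \<gamma> * L\<^sub>f) / (1 - \<gamma> * \<rho>))-lipschitz_on UNIV (\<lambda>u. Y_FB f g u \<gamma>)"
    using bound L \<gamma>\<rho> assms(7) by (intro lipschitz_onI) (auto simp: dist_norm)
  then show ?thesis using bound by blast
qed

end
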